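(* Assume $k\ge2\cdot10^8$, the stream is in random order, no dense set exists, and $\Pr[f(S_L)\le\alpha\,\mathrm{OPT}]\ge0.99$ with $\alpha=3\cdot10^{-3}$, where $S_L$ denotes the set of elements selected by Algorithm 2 among the positions $i\le\beta n$, $\beta=10^{-3}$. Then, with probability at least $0.49\,\eta$, the output $S$ of Algorithm 2 satisfies $f(S)\ge\frac{1+\epsilon}{2}\mathrm{OPT}$.
   Context: $V$ is a finite ground set with $|V|=n$; $f:2^V\to\mathbb{R}_{\ge0}$ is monotone, submodular and normalized; $f(X\mid Y)=f(X\cup Y)-f(Y)$, $f(e\mid Y)=f(\{e\}\mid Y)$. $k\le n$ is a positive integer, $\mathrm{OPT}=\max\{f(S):S\subseteq V,|S|\le k\}$, and $\mathcal O$ is a fixed set with $|\mathcal O|=k$, $f(\mathcal O)=\mathrm{OPT}$. A stream is an ordering $e_1,\dots,e_n$ of $V$; "random order" means a uniformly random permutation. A set $D$ is dense if $|D|\le\eta k$ and $f(D)\ge\frac{1-\gamma}{2}\mathrm{OPT}$, where $\gamma=10^{-2}$, $\eta=5\cdot10^{-5}$. Algorithm 2 (knows $\mathrm{OPT}$), with $\epsilon=10^{-8}$: start with $S=\emptyset$; for $i=1,\dots,n$, add $e_i$ to $S$ if $|S|<k$ and $f(e_i\mid S)\ge\frac{1+\epsilon}{2}\cdot\frac{\mathrm{OPT}}{k}$; return $S$. *)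

theory Defs
  imports Complex_Main "HOL-Combinatorics.Multiset_Permutations"
begin

definition mono_submod_normalized :: "'a set \<Rightarrow> ('a set \<Rightarrow> real) \<Rightarrow> bool" where
  "mono_submod_normalized V f \<longleftrightarrow>
     f {} = 0 \<and>
     (\<forall>X. X \<subseteq> V \<longrightarrow> f X \<ge> 0) \<and>
     (\<forall>A B. A \<subseteq> B \<and> B \<subseteq> V \<longrightarrow> f A \<le> f B) \<and>
     (\<forall>A B. A \<subseteq> V \<and> B \<subseteq> V \<longrightarrow> f (A \<union> B) + f (A \<inter> B) \<le> f A + f B)"

definition OPT :: "'a set \<Rightarrow> ('a set \<Rightarrow> real) \<Rightarrow> nat \<Rightarrow> real" where
  "OPT V f k = Max {f S | S. S \<subseteq> V \<and> card S \<le> k}"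

definition gamma_c :: real where "gamma_c = 1/100"
definition eta_c :: real where "eta_c = 5 / 10^5"
definition eps_c :: real where "eps_c = 1 / 10^8"

definition dense :: "'a set \<Rightarrow> ('a set \<Rightarrow> real) \<Rightarrow> nat \<Rightarrow> 'a set \<Rightarrow> bool" where
  "dense V f k D \<longleftrightarrow> D \<subseteq> V \<and> real (card D) \<le> eta_c * real k
      \<and> f D \<ge> (1 - gamma_c) / 2 * OPT V f k"

definition alg2_step :: "('a set \<Rightarrow> real) \<Rightarrow> nat \<Rightarrow> real \<Rightarrow> 'a set \<Rightarrow> 'a \<Rightarrow> 'a set" where
  "alg2_step f k opt S e =
     (if card S < k \<and> f (insert e S) - f S \<ge> (1 + eps_c) / 2 * (opt / real k)
      then insert e S else S)"

definition alg2 :: "('a set \<Rightarrow> real) \<Rightarrow> nat \<Rightarrow> real \<Rightarrow> 'a list \<Rightarrow> 'a set" where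
  "alg2 f k opt xs = foldl (alg2_step f k opt) {} xs"

text \<open>S_L: elements selected by Algorithm 2 (run on the whole stream) at positions i \<le> beta n
  (1-indexed). Since the algorithm is online, this is the set held after processing the first
  floor(beta n) elements.\<close>
definition alg2_SL :: "('a set \<Rightarrow> real) \<Rightarrow> nat \<Rightarrow> real \<Rightarrow> real \<Rightarrow> 'a list \<Rightarrow> 'a set" where
  "alg2_SL f k opt beta xs = alg2 f k opt (take (nat \<lfloor>beta * real (length xs)\<rfloor>) xs)"

definition prob_perm :: "'a set \<Rightarrow> ('a list \<Rightarrow> bool) \<Rightarrow> real" where
  "prob_perm V P = real (card {xs \<in> permutations_of_set V. P xs}) / real (card (permutations_of_set V))"

end

(* Let l = floor (n / 1000), and let Q be an optimal set. If S_L has small value, then more than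
   eta k elements of Q still have marginal at least the threshold with respect to S_L, since
   otherwise they would form a dense set. By submodularity such an element would have been selected
   at every one of the first l positions, so moving it to a random position shows that about
   eta k / 1000 elements of Q are selected in the prefix on average. Since the prefix contains
   about k / 1000 elements of Q (Chebyshev), at least 2 eps k of them are selected with
   probability about (eta / 1000 - 2 eps) / (1 / 1000) > 0.49 eta. In that case either k elements
   are selected, each gaining the threshold, or all rejected elements have small marginals and the
   2 eps k elements saved in OPT <= f S + |Q - S| * threshold lift the bound above (1 + eps) / 2. *)

theory Submission
  imports Defs
begin

section \<open>Submodular functions\<close>

lemma mono_submodD:
  assumes "mono_submod_normalized V f"
  shows "f {} = 0"
    and "A \<subseteq> B \<Longrightarrow> B \<subseteq> V \<Longrightarrow> f A \<le> f B"
    and "A \<subseteq> V \<Longrightarrow> B \<subseteq> V \<Longrightarrow> f (A \<union> B) + f (A \<inter> B) \<le> f A + f B"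
  using assms unfolding mono_submod_normalized_def by blast+

text \<open>If \<open>e\<close> lies outside \<open>B\<close>, this is submodularity for the pair
  \<open>insert e A\<close> and \<open>B\<close>, whose intersection is \<open>A\<close>. If
  \<open>e\<close> lies in \<open>B\<close>, the left side is zero and monotonicity
  suffices.\<close>

lemma marginal_antimono:
  assumes f: "mono_submod_normalized V f" and "A \<subseteq> B" "B \<subseteq> V" "e \<in> V"
  shows "f (insert e B) - f B \<le> f (insert e A) - f A"
proof (cases "e \<in> B")
  case True
  then have "f A \<le> f (insert e A)"
    using assms by (intro mono_submodD(2)[OF f]) auto
  then show ?thesis using True by (simp add: insert_absorb)
next
  case False
  have "insert e A \<union> B = insert e B" "insert e A \<inter> B = A"
    using assms False by auto
  then show ?thesis
    using mono_submodD(3)[OF f, of "insert e A" B] assms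
    by (simp add: order_trans[OF \<open>A \<subseteq> B\<close>])
qed

text \<open>Add the elements of \<open>T\<close> one at a time: the gain of each over the growing
  set is at most its gain over \<open>X\<close>, by diminishing returns.\<close>

lemma union_le_card_marginals:
  assumes f: "mono_submod_normalized V f" and "finite T" "X \<subseteq> V" "T \<subseteq> V"
    and "\<And>e. e \<in> T \<Longrightarrow> f (insert e X) - f X \<le> c"
  shows "f (X \<union> T) \<le> f X + real (card T) * c"
  using assms(2,4,5)
proof (induction T rule: finite_induct)
  case (insert e T)
  have "f (insert e (X \<union> T)) - f (X \<union> T) \<le> f (insert e X) - f X"
    using insert.prems \<open>X \<subseteq> V\<close> by (intro marginal_antimono[OF f]) auto
  also have "\<dots> \<le> c" using insert.prems by auto
  finally have "f (insert e (X \<union> T)) \<le> f (X \<union> T) + c" by simp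
  moreover have "f (X \<union> T) \<le> f X + real (card T) * c"
    using insert by auto
  ultimately show ?case using insert by (simp add: algebra_simps)
qed simp

lemma OPT_attained:
  assumes "finite V"
  shows "\<exists>Q\<subseteq>V. card Q \<le> k \<and> f Q = OPT V f k"
proof -
  have "{f S |S. S \<subseteq> V \<and> card S \<le> k} \<subseteq> f ` Pow V" by auto
  then have "finite {f S |S. S \<subseteq> V \<and> card S \<le> k}"
    using assms finite_subset by blast
  moreover have "{f S |S. S \<subseteq> V \<and> card S \<le> k} \<noteq> {}"
    by (auto intro: exI[of _ "{}"])
  ultimately have "OPT V f k \<in> {f S |S. S \<subseteq> V \<and> card S \<le> k}"
    unfolding OPT_def by (rule Max_in)
  then show ?thesis by auto
qed

text \<open>Otherwise the empty set, of value 0, would itself be dense.\<close>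

lemma OPT_pos_if_no_dense:
  assumes "mono_submod_normalized V f" "\<not> (\<exists>D. dense V f k D)"
  shows "OPT V f k > 0"
proof (rule ccontr)
  assume "\<not> OPT V f k > 0"
  then have "dense V f k {}"
    using mono_submodD(1)[OF assms(1)]
    by (simp add: dense_def gamma_c_def eta_c_def)
  with assms(2) show False by blast
qed

section \<open>The threshold algorithm\<close>

abbreviation alg2_threshold :: "nat \<Rightarrow> real \<Rightarrow> real" where
  "alg2_threshold k opt \<equiv> (1 + eps_c) / 2 * (opt / real k)"

lemma alg2_Nil [simp]: "alg2 f k opt [] = {}"
  by (simp add: alg2_def)

lemma alg2_snoc: "alg2 f k opt (xs @ [e]) = alg2_step f k opt (alg2 f k opt xs) e"
  by (simp add: alg2_def)

lemma alg2_append_mono: "alg2 f k opt xs \<subseteq> alg2 f k opt (xs @ ys)"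
proof (induction ys rule: rev_induct)
  case (snoc e ys)
  have "alg2 f k opt (xs @ ys) \<subseteq> alg2 f k opt ((xs @ ys) @ [e])"
    unfolding alg2_snoc alg2_step_def by auto
  with snoc show ?case by auto
qed simp

lemma alg2_subset: "alg2 f k opt xs \<subseteq> set xs"
  by (induction xs rule: rev_induct) (auto simp: alg2_snoc alg2_step_def split: if_splits)

lemma finite_alg2 [simp]: "finite (alg2 f k opt xs)"
  by (rule finite_subset[OF alg2_subset]) simp

lemma card_alg2_le: "card (alg2 f k opt xs) \<le> k"
proof (induction xs rule: rev_induct)
  case (snoc e xs)
  then show ?case
    using card_insert_le_m1[of k "alg2 f k opt xs" e]
    by (auto simp: alg2_snoc alg2_step_def card_insert_if)
qed simp

text \<open>The value starts at zero, and every selected element raised it by at least the threshold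
  at the moment of its selection.\<close>

lemma alg2_value_ge:
  assumes "f {} = 0"
  shows "real (card (alg2 f k opt xs)) * alg2_threshold k opt \<le> f (alg2 f k opt xs)"
proof (induction xs rule: rev_induct)
  case (snoc e xs)
  define t where "t = alg2_threshold k opt"
  define S where "S = alg2 f k opt xs"
  have IH: "real (card S) * t \<le> f S" using snoc by (simp add: S_def t_def)
  have step: "alg2 f k opt (xs @ [e]) =
      (if card S < k \<and> f (insert e S) - f S \<ge> t then insert e S else S)"
    by (simp add: alg2_snoc alg2_step_def S_def t_def)
  show ?case
  \<comment> \<open>The list may contain repetitions, so an element already in \<open>S\<close> is
    kept apart: inserting it again changes neither the set nor its cardinality.\<close>
  proof (cases "e \<notin> S \<and> card S < k \<and> f (insert e S) - f S \<ge> t")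
    case True
    then have "real (card (insert e S)) * t = real (card S) * t + t"
      by (simp add: S_def distrib_right)
    then show ?thesis using True IH step unfolding t_def[symmetric] by simp
  next
    case False
    then have "alg2 f k opt (xs @ [e]) = S" using step by (auto simp: insert_absorb)
    then show ?thesis using IH unfolding t_def[symmetric] by simp
  qed
qed (use assms in simp)

text \<open>When \<open>e\<close> arrived, the set was a subset of the final one and so had not
  reached the cap. Hence \<open>e\<close> was rejected for its small marginal, and marginals only
  shrink as the set grows.\<close>

lemma alg2_rejected_marginal_less:
  assumes f: "mono_submod_normalized V f" and "set xs \<subseteq> V"
    and "card (alg2 f k opt xs) < k" "e \<in> set xs" "e \<notin> alg2 f k opt xs"
  shows "f (insert e (alg2 f k opt xs)) - f (alg2 f k opt xs) < alg2_threshold k opt"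
proof -
  obtain us vs where xs: "xs = us @ e # vs"
    using assms(4) by (meson split_list)
  have sub: "alg2 f k opt us \<subseteq> alg2 f k opt xs"
    unfolding xs by (rule alg2_append_mono)
  have "alg2 f k opt (us @ [e]) \<subseteq> alg2 f k opt xs"
    using alg2_append_mono[of f k opt "us @ [e]" vs] xs by simp
  with assms(5) have "e \<notin> alg2 f k opt (us @ [e])" by blast
  moreover have "card (alg2 f k opt us) < k"
    using card_mono[OF _ sub] assms(3) by simp
  ultimately have "f (insert e (alg2 f k opt us)) - f (alg2 f k opt us) < alg2_threshold k opt"
    by (auto simp: alg2_snoc alg2_step_def split: if_splits)
  moreover have "f (insert e (alg2 f k opt xs)) - f (alg2 f k opt xs)
      \<le> f (insert e (alg2 f k opt us)) - f (alg2 f k opt us)"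
    using sub assms alg2_subset[of f k opt xs] by (intro marginal_antimono[OF f]) auto
  ultimately show ?thesis by linarith
qed

lemma alg2_value_if_many_optimal_selected:
  assumes f: "mono_submod_normalized V f" and "finite V" "set xs = V"
    and Q: "Q \<subseteq> V" "card Q \<le> k" "f Q = opt" and "opt > 0"
    and many: "real (card (Q \<inter> alg2 f k opt xs)) \<ge> 2 * eps_c * real k"
  shows "f (alg2 f k opt xs) \<ge> (1 + eps_c) / 2 * opt"
proof -
  define S where "S = alg2 f k opt xs"
  define t where "t = alg2_threshold k opt"
  have eps: "0 < eps_c" by (simp add: eps_c_def)
  show ?thesis
  proof (cases "k = 0")
    \<comment> \<open>Here the threshold is zero by the convention for division, but
      \<open>Q\<close> is empty, so \<open>opt = f {} = 0\<close> contradicts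
      \<open>opt > 0\<close>.\<close>
    case True
    then have "Q = {}" using Q(2) finite_subset[OF Q(1) \<open>finite V\<close>] by simp
    then show ?thesis using Q \<open>opt > 0\<close> mono_submodD(1)[OF f] by simp
  next
    case False
    then have k: "real k > 0" by simp
    have kt: "real k * t = (1 + eps_c) / 2 * opt"
      using k by (simp add: t_def)
    have t: "t > 0" using k \<open>opt > 0\<close> eps by (simp add: t_def)
    show ?thesis
    proof (cases "card S = k")
      case True
      then show ?thesis
        using alg2_value_ge[where f = f and k = k and opt = opt and xs = xs] mono_submodD(1)[OF f] kt
        by (simp add: S_def t_def)
    next
      case False
      then have "card S < k" using card_alg2_le[of f k opt xs] S_def by simp
      have SV: "S \<subseteq> V" using alg2_subset[of f k opt xs] assms by (simp add: S_def)
      have finQ: "finite Q" by (rule finite_subset[OF Q(1) \<open>finite V\<close>])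
      have "opt \<le> f (S \<union> (Q - S))"
        using Q SV by (auto simp flip: Q(3) intro!: mono_submodD(2)[OF f])
      also have "\<dots> \<le> f S + real (card (Q - S)) * t"
      proof (rule union_le_card_marginals[OF f])
        fix e assume "e \<in> Q - S"
        then have "e \<in> set xs" "e \<notin> S" using Q(1) \<open>set xs = V\<close> by auto
        then show "f (insert e S) - f S \<le> t"
          using alg2_rejected_marginal_less[OF f, of xs k opt e] \<open>set xs = V\<close> \<open>card S < k\<close>
          by (simp add: S_def t_def)
      qed (use Q SV finQ in auto)
      also have "real (card (Q - S)) = real (card Q) - real (card (Q \<inter> S))"
        using finQ by (simp add: card_Diff_subset_Int of_nat_diff card_mono)
      also have "f S + (real (card Q) - real (card (Q \<inter> S))) * t
          \<le> f S + (real k - 2 * eps_c * real k) * t"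
        using many Q t by (intro add_left_mono mult_right_mono) (auto simp: S_def)
      also have "\<dots> = f S + (1 - 2 * eps_c) * (1 + eps_c) / 2 * opt"
      proof -
        have "(real k - 2 * eps_c * real k) * t = (1 - 2 * eps_c) * (real k * t)"
          by (simp add: algebra_simps)
        then show ?thesis unfolding kt by simp
      qed
      finally have "f S \<ge> (1 - (1 - 2 * eps_c) * (1 + eps_c) / 2) * opt"
        by (simp add: algebra_simps)
      \<comment> \<open>The two coefficients differ by exactly the square of \<open>eps_c\<close>.
        This is where the amount \<open>2 * eps_c * real k\<close> of selected elements comes
        from.\<close>
      moreover have "(1 - (1 - 2 * eps_c) * (1 + eps_c) / 2) * opt \<ge> (1 + eps_c) / 2 * opt"
        using \<open>opt > 0\<close> by (intro mult_right_mono) (auto simp: eps_c_def)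
      ultimately show ?thesis by (simp add: S_def)
    qed
  qed
qed

text \<open>If the elements with large marginal were few, they would not form a dense set, and the
  value of \<open>Q\<close> would be at most \<open>\<alpha> + (1 - \<gamma>) / 2 + (1 + \<epsilon>) / 2 < 1\<close> times the optimum.\<close>

lemma many_large_marginals_if_no_dense:
  assumes f: "mono_submod_normalized V f" and "finite V"
    and no_dense: "\<not> (\<exists>D. dense V f k D)"
    and Q: "Q \<subseteq> V" "card Q \<le> k" "f Q = OPT V f k"
    and S: "S \<subseteq> V" "f S \<le> 3 / 1000 * OPT V f k"
  shows "real (card {e \<in> Q. f (insert e S) - f S \<ge> alg2_threshold k (OPT V f k)}) > eta_c * real k"
    (is "real (card ?B) > _")
proof (rule ccontr)
  define opt where "opt = OPT V f k"
  define t where "t = alg2_threshold k opt"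
  have opt: "opt > 0" using OPT_pos_if_no_dense[OF f no_dense] by (simp add: opt_def)
  then have "t \<ge> 0" by (simp add: t_def eps_c_def)
  \<comment> \<open>An inequality rather than an equation, because the left side is zero for
    \<open>k = 0\<close>.\<close>
  have kt: "real k * t \<le> (1 + eps_c) / 2 * opt"
    using opt by (simp add: t_def eps_c_def)
  assume small: "\<not> real (card ?B) > eta_c * real k"
  have "\<not> dense V f k ?B" using no_dense by blast
  moreover have "?B \<subseteq> V" using Q(1) by blast
  ultimately have B: "f ?B < (1 - gamma_c) / 2 * opt"
    using small unfolding dense_def opt_def not_less by (meson not_le)
  have finQ: "finite Q" by (rule finite_subset[OF Q(1) \<open>finite V\<close>])
  have "opt \<le> f ((S \<union> ?B) \<union> (Q - ?B))"
    unfolding opt_def Q(3)[symmetric] using Q S by (intro mono_submodD(2)[OF f]) auto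
  also have "\<dots> \<le> f (S \<union> ?B) + real (card (Q - ?B)) * t"
  proof (rule union_le_card_marginals[OF f])
    fix e assume e: "e \<in> Q - ?B"
    then have "f (insert e (S \<union> ?B)) - f (S \<union> ?B) \<le> f (insert e S) - f S"
      using Q S by (intro marginal_antimono[OF f]) auto
    also have "\<dots> \<le> t" using e by (auto simp: t_def opt_def)
    finally show "f (insert e (S \<union> ?B)) - f (S \<union> ?B) \<le> t" .
  qed (use Q S finQ in auto)
  also have "real (card (Q - ?B)) * t \<le> real k * t"
    using Q(2) card_mono[OF finQ Diff_subset, of ?B] \<open>t \<ge> 0\<close> by (intro mult_right_mono) auto
  also have "f (S \<union> ?B) \<le> f S + f ?B"
  proof -
    have "?B \<subseteq> V" using Q by auto
    then have "f (S \<union> ?B) + f (S \<inter> ?B) \<le> f S + f ?B"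
      using S by (intro mono_submodD(3)[OF f]) auto
    moreover have "f {} \<le> f (S \<inter> ?B)" using S by (intro mono_submodD(2)[OF f]) auto
    ultimately show ?thesis using mono_submodD(1)[OF f] by linarith
  qed
  finally show False
    using B kt S(2) opt by (simp add: gamma_c_def eps_c_def opt_def[symmetric] field_simps)
qed

section \<open>Inserting an element into a permutation\<close>

definition insert_nth :: "nat \<Rightarrow> 'a \<Rightarrow> 'a list \<Rightarrow> 'a list" where
  "insert_nth i x ys = take i ys @ x # drop i ys"

text \<open>Since \<open>x\<close> does not occur in \<open>ys\<close>, splitting a permutation at
  \<open>x\<close> recovers both the position of \<open>x\<close> and the order of the other
  elements.\<close>

lemma bij_betw_insert_nth:
  assumes "finite V" "x \<in> V"
  shows "bij_betw (\<lambda>(ys, i). insert_nth i x ys)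
    (permutations_of_set (V - {x}) \<times> {..<card V}) (permutations_of_set V)"
proof (rule bij_betwI')
  fix a b assume "a \<in> permutations_of_set (V - {x}) \<times> {..<card V}"
    "b \<in> permutations_of_set (V - {x}) \<times> {..<card V}"
  then obtain ys i zs j where ab: "a = (ys, i)" "b = (zs, j)" "x \<notin> set ys" "x \<notin> set zs"
    "length ys = card (V - {x})" "length zs = card (V - {x})" "i < card V" "j < card V"
    using assms by (auto simp: permutations_of_set_def distinct_card[symmetric])
  then have len: "i \<le> length ys" "j \<le> length zs"
    using assms by auto
  show "((case a of (ys, i) \<Rightarrow> insert_nth i x ys) = (case b of (ys, i) \<Rightarrow> insert_nth i x ys)) = (a = b)"
  proof
    assume "(case a of (ys, i) \<Rightarrow> insert_nth i x ys) = (case b of (ys, i) \<Rightarrow> insert_nth i x ys)"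
    then have "take i ys @ x # drop i ys = take j zs @ x # drop j zs"
      using ab by (simp add: insert_nth_def)
    moreover have "x \<notin> set (take i ys)" "x \<notin> set (drop i ys)"
      "x \<notin> set (take j zs)" "x \<notin> set (drop j zs)"
      using ab by (meson in_set_takeD in_set_dropD)+
    ultimately have eq: "take i ys = take j zs" "drop i ys = drop j zs"
      by (auto simp: append_Cons_eq_iff)
    then have "ys = zs" by (metis append_take_drop_id)
    moreover have "i = j" using arg_cong[OF eq(1), of length] len by simp
    ultimately show "a = b" using ab by simp
  qed simp
next
  fix a assume "a \<in> permutations_of_set (V - {x}) \<times> {..<card V}"
  then obtain ys i where a: "a = (ys, i)" and ys: "set ys = V - {x}" "distinct ys"
    by (auto simp: permutations_of_set_def)
  have "set (take i ys) \<union> set (drop i ys) = V - {x}"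
    using ys by (metis append_take_drop_id set_append)
  moreover have "set (take i ys) \<inter> set (drop i ys) = {}"
    using ys by (simp add: set_take_disj_set_drop_if_distinct)
  ultimately show "(case a of (ys, i) \<Rightarrow> insert_nth i x ys) \<in> permutations_of_set V"
    using ys \<open>x \<in> V\<close> by (auto simp: a permutations_of_set_def insert_nth_def)
next
  fix xs assume xs: "xs \<in> permutations_of_set V"
  then obtain us vs where uv: "xs = us @ x # vs"
    using assms by (metis permutations_of_setD(1) split_list)
  have "us @ vs \<in> permutations_of_set (V - {x})"
    using xs unfolding uv permutations_of_set_def by auto
  moreover have "length us < card V"
    using length_finite_permutations_of_set[OF xs] by (simp add: uv)
  moreover have "xs = insert_nth (length us) x (us @ vs)"
    by (simp add: insert_nth_def uv)
  ultimately show "\<exists>a\<in>permutations_of_set (V - {x}) \<times> {..<card V}.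
      xs = (case a of (ys, i) \<Rightarrow> insert_nth i x ys)"
    by force
qed

text \<open>In probabilistic terms, the position of \<open>x\<close> in a random order is uniform
  and independent of the arrangement of the other elements.\<close>

lemma sum_permutations_insert_nth:
  assumes "finite V" "x \<in> V"
  shows "(\<Sum>xs\<in>permutations_of_set V. g xs) =
    (\<Sum>ys\<in>permutations_of_set (V - {x}). \<Sum>i<card V. g (insert_nth i x ys))"
  unfolding sum.cartesian_product
  by (subst sum.reindex_bij_betw[OF bij_betw_insert_nth[OF assms], symmetric])
    (simp add: case_prod_beta)

lemma mem_take_insert_nth_self:
  assumes "x \<notin> set ys" "i \<le> length ys"
  shows "x \<in> set (take l (insert_nth i x ys)) \<longleftrightarrow> i < l"
proof (cases "i < l")
  case True
  then show ?thesis using assms by (auto simp: insert_nth_def take_Cons' min_def)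
next
  case False
  then show ?thesis using assms by (auto simp: insert_nth_def min_def dest: in_set_takeD)
qed

lemma take_insert_nth_ge: "l \<le> i \<Longrightarrow> i \<le> length ys \<Longrightarrow> take l (insert_nth i x ys) = take l ys"
  by (simp add: insert_nth_def min_def)

text \<open>The inserted element occupies one of the \<open>l\<close> places of the prefix, which
  leaves \<open>l - 1\<close> of them for \<open>ys\<close>.\<close>

lemma set_take_insert_nth_less:
  assumes "i < l" "i \<le> length ys"
  shows "set (take l (insert_nth i x ys)) = insert x (set (take (l - 1) ys))"
proof -
  have "take (l - 1) ys = take i ys @ take (l - 1 - i) (drop i ys)"
    using assms by (metis Suc_pred' add_diff_inverse_nat less_Suc_eq_le not_less not_less0 gr0I take_add)
  then show ?thesis using assms by (simp add: insert_nth_def take_Cons' min_def)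
qed

lemma length_permutation_remove:
  assumes "finite V" "x \<in> V" "ys \<in> permutations_of_set (V - {x})"
  shows "length ys = card V - 1" "x \<notin> set ys" "set ys \<subseteq> V"
  using assms by (auto simp: permutations_of_set_def distinct_card[symmetric] dest!: distinct_card)

text \<open>Each arrangement of the other elements that admits some position satisfying \<open>P\<close> has \<open>l\<close>
  positions satisfying \<open>Q\<close>, out of \<open>card V\<close>.\<close>

lemma reinsertion_count:
  fixes P Q :: "'a list \<Rightarrow> bool"
  assumes V: "finite V" "x \<in> V" and l: "l \<le> card V"
    and PQ: "\<And>ys p q. ys \<in> permutations_of_set (V - {x}) \<Longrightarrow> p < card V \<Longrightarrow>
      P (insert_nth p x ys) \<Longrightarrow> q < l \<Longrightarrow> Q (insert_nth q x ys)"
  shows "real l * (\<Sum>xs\<in>permutations_of_set V. of_bool (P xs))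
    \<le> real (card V) * (\<Sum>xs\<in>permutations_of_set V. of_bool (Q xs))"
  unfolding sum_permutations_insert_nth[OF V] sum_distrib_left[of _ _ "permutations_of_set _"]
proof (rule sum_mono)
  fix ys assume ys: "ys \<in> permutations_of_set (V - {x})"
  show "real l * (\<Sum>i<card V. of_bool (P (insert_nth i x ys)))
    \<le> real (card V) * (\<Sum>i<card V. of_bool (Q (insert_nth i x ys)))"
  proof (cases "\<exists>p<card V. P (insert_nth p x ys)")
    case True
    then have Q: "Q (insert_nth q x ys)" if "q < l" for q
      using PQ[OF ys] that by blast
    \<comment> \<open>At most \<open>card V\<close> positions satisfy \<open>P\<close>, while all of
      the first \<open>l\<close> positions satisfy \<open>Q\<close>; multiplying the two bounds
      gives the claim for \<open>ys\<close>.\<close>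
    have "(\<Sum>i<card V. of_bool (P (insert_nth i x ys))) \<le> (\<Sum>i<card V. 1 :: real)"
      by (intro sum_mono) simp
    moreover have "real l \<le> (\<Sum>i<card V. of_bool (Q (insert_nth i x ys)))"
    proof -
      have "real l = (\<Sum>i<l. of_bool (Q (insert_nth i x ys)))" using Q by simp
      also have "\<dots> \<le> (\<Sum>i<card V. of_bool (Q (insert_nth i x ys)))"
        using l by (intro sum_mono2) auto
      finally show ?thesis .
    qed
    ultimately have "real l * (\<Sum>i<card V. of_bool (P (insert_nth i x ys)))
      \<le> (\<Sum>i<card V. of_bool (Q (insert_nth i x ys))) * real (card V)"
      by (intro mult_mono) (auto intro: sum_nonneg)
    then show ?thesis by (simp add: mult.commute)
  next
    case False
    then have "(\<Sum>i<card V. of_bool (P (insert_nth i x ys))) = (0 :: real)"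
      by (intro sum.neutral) auto
    moreover have "0 \<le> (\<Sum>i<card V. of_bool (Q (insert_nth i x ys)) :: real)"
      by (intro sum_nonneg) simp
    ultimately show ?thesis by simp
  qed
qed

section \<open>Concentration of the number of elements in a prefix\<close>

text \<open>Each of the \<open>fact (card V - 1)\<close> arrangements of the other elements admits
  exactly the \<open>l\<close> positions \<open>i < l\<close> for \<open>x\<close>. This is the
  probability \<open>l / card V\<close>, scaled by the number of permutations.\<close>

lemma sum_mem_take:
  assumes V: "finite V" "x \<in> V" and "l \<le> card V"
  shows "(\<Sum>xs\<in>permutations_of_set V. of_bool (x \<in> set (take l xs))) = (real l * fact (card V - 1))"
proof -
  have "(\<Sum>i<card V. of_bool (x \<in> set (take l (insert_nth i x ys)))) = real l"
    if ys: "ys \<in> permutations_of_set (V - {x})" for ys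
  proof -
    have "(\<Sum>i<card V. of_bool (x \<in> set (take l (insert_nth i x ys)))) =
        (\<Sum>i<card V. if i < l then 1 else (0 :: real))"
      using length_permutation_remove[OF V ys] by (intro sum.cong) (auto simp: mem_take_insert_nth_self)
    also have "\<dots> = (\<Sum>i\<in>{..<card V} \<inter> {i. i < l}. 1)"
      by (subst sum.inter_restrict) (auto intro!: sum.cong)
    also have "{..<card V} \<inter> {i. i < l} = {..<l}" using \<open>l \<le> card V\<close> by auto
    finally show ?thesis by simp
  qed
  then show ?thesis
    using V by (simp add: sum_permutations_insert_nth[OF V] card_Diff_singleton)
qed

text \<open>Once \<open>x\<close> is placed in the prefix, \<open>y\<close> has to be among the
  first \<open>l - 1\<close> of the remaining elements, so the count for a single element applies to
  \<open>V - {x}\<close>.\<close>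

lemma sum_mem_take_pair:
  assumes V: "finite V" "x \<in> V" and "y \<in> V" "x \<noteq> y" "l \<le> card V"
  shows "(\<Sum>xs\<in>permutations_of_set V. of_bool (x \<in> set (take l xs)) * of_bool (y \<in> set (take l xs)))
    = (real l * real (l - 1) * fact (card V - 2))"
proof -
  have "(\<Sum>i<card V. of_bool (x \<in> set (take l (insert_nth i x ys))) *
      of_bool (y \<in> set (take l (insert_nth i x ys)))) = real l * of_bool (y \<in> set (take (l - 1) ys))"
    if ys: "ys \<in> permutations_of_set (V - {x})" for ys
  proof -
    have "(\<Sum>i<card V. of_bool (x \<in> set (take l (insert_nth i x ys))) *
        of_bool (y \<in> set (take l (insert_nth i x ys)))) =
        (\<Sum>i<card V. if i < l then of_bool (y \<in> set (take (l - 1) ys)) else (0 :: real))"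
      using length_permutation_remove[OF V ys] \<open>x \<noteq> y\<close>
      by (intro sum.cong) (auto simp: mem_take_insert_nth_self set_take_insert_nth_less)
    also have "\<dots> = (\<Sum>i\<in>{..<card V} \<inter> {i. i < l}. of_bool (y \<in> set (take (l - 1) ys)))"
      by (subst sum.inter_restrict) (auto intro: sum.cong)
    also have "{..<card V} \<inter> {i. i < l} = {..<l}" using \<open>l \<le> card V\<close> by auto
    finally show ?thesis by simp
  qed
  then have "(\<Sum>xs\<in>permutations_of_set V. of_bool (x \<in> set (take l xs)) * of_bool (y \<in> set (take l xs)))
      = real l * (\<Sum>ys\<in>permutations_of_set (V - {x}). of_bool (y \<in> set (take (l - 1) ys)))"
    by (simp add: sum_permutations_insert_nth[OF V] sum_distrib_left)
  also have "\<dots> = real l * (real (l - 1) * fact (card (V - {x}) - 1))"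
    using assms by (subst sum_mem_take) (auto simp: card_Diff_singleton)
  finally show ?thesis using assms by (simp add: card_Diff_singleton numeral_2_eq_2)
qed

text \<open>The number of elements of \<open>Q\<close> in the prefix is hypergeometric, and its variance is at most
  its mean.\<close>

lemma prefix_count_variance:
  assumes V: "finite V" "Q \<subseteq> V" and l: "l \<le> card V"
  defines "m \<equiv> real (card Q) * real l / real (card V)"
  shows "(\<Sum>xs\<in>permutations_of_set V. (real (card (Q \<inter> set (take l xs))) - m)\<^sup>2) \<le> fact (card V) * m"
proof (cases "Q = {}")
  case False
  define n where "n = card V"
  define I where "I x xs = (of_bool (x \<in> set (take l xs)) :: real)" for x :: 'a and xs
  have finQ: "finite Q" by (rule finite_subset[OF V(2) V(1)])
  have n0: "n > 0" using False V by (auto simp: n_def card_gt_0_iff)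
  have Y: "real (card (Q \<inter> set (take l xs))) = (\<Sum>x\<in>Q. I x xs)" for xs
    using finQ by (simp add: I_def of_bool_def sum.inter_restrict[symmetric] flip: sum.inter_restrict)
  have fact1: "fact n = real n * fact (n - 1)" using n0 by (metis fact_reduce)
  have single: "(\<Sum>xs\<in>permutations_of_set V. I x xs) = fact n * (real l / real n)" if "x \<in> Q" for x
    using sum_mem_take[of V x l] that V l n0 fact1 by (auto simp: I_def n_def)
  \<comment> \<open>Negative correlation of the indicators of distinct elements:
    \<open>l (l - 1) / (n (n - 1))\<close> is at most \<open>(l / n)^2\<close> because
    \<open>l \<le> n\<close>.\<close>
  have pair: "(\<Sum>xs\<in>permutations_of_set V. I x xs * I y xs) \<le> fact n * (real l / real n)\<^sup>2"
    if "x \<in> Q" "y \<in> Q" "x \<noteq> y" for x y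
  proof -
    have "card {x, y} \<le> n" unfolding n_def using that V by (intro card_mono) auto
    then have n2: "n \<ge> 2" using that by simp
    then have fact2: "fact (n - 1) = real (n - 1) * fact (n - 2)"
      by (subst fact_reduce) (auto simp: numeral_2_eq_2)
    have "real l * real (l - 1) * (real n * real n) \<le> real l * real l * (real n * real (n - 1))"
    proof -
      have "real (l - 1) * real n \<le> real l * real (n - 1)"
        using l n0 by (cases l) (auto simp: n_def of_nat_diff algebra_simps)
      then have "(real l * real n) * (real (l - 1) * real n) \<le> (real l * real n) * (real l * real (n - 1))"
        by (intro mult_left_mono) auto
      then show ?thesis by (simp add: mult_ac)
    qed
    then have "real l * real (l - 1) \<le> real n * real (n - 1) * (real l / real n)\<^sup>2"
      using n0 by (simp add: field_simps power2_eq_square)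
    then have "real l * real (l - 1) * fact (n - 2) \<le> real n * real (n - 1) * (real l / real n)\<^sup>2 * fact (n - 2)"
      by (intro mult_right_mono) auto
    also have "\<dots> = fact n * (real l / real n)\<^sup>2"
      unfolding fact1 fact2 by (simp only: mult_ac)
    finally show ?thesis
      using sum_mem_take_pair[of V x y l] that subsetD[OF V(2)] V(1) l by (simp add: I_def n_def)
  qed
  define c where "c = real (card Q)"
  have c: "c \<ge> 0" by (simp add: c_def)
  have m: "m = c * (real l / real n)" by (simp add: m_def c_def n_def)
  have first: "(\<Sum>xs\<in>permutations_of_set V. \<Sum>x\<in>Q. I x xs) = fact n * m"
    by (subst sum.swap) (simp add: single c_def m)
  have "(\<Sum>xs\<in>permutations_of_set V. (\<Sum>x\<in>Q. I x xs)\<^sup>2)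
      = (\<Sum>x\<in>Q. \<Sum>y\<in>Q. \<Sum>xs\<in>permutations_of_set V. I x xs * I y xs)"
    by (simp add: power2_eq_square sum_product sum.swap[of _ Q "permutations_of_set V"])
  \<comment> \<open>Indicators are idempotent, so a diagonal term is the first moment of a single
    indicator. Granting it the square as well makes the double sum split into the mean and the
    squared mean.\<close>
  also have "\<dots> \<le> (\<Sum>x\<in>Q. \<Sum>y\<in>Q. of_bool (x = y) * (fact n * (real l / real n)) + fact n * (real l / real n)\<^sup>2)"
  proof (intro sum_mono)
    fix x y assume xy: "x \<in> Q" "y \<in> Q"
    have idem: "I z xs * I z xs = I z xs" for z xs by (simp add: I_def)
    show "(\<Sum>xs\<in>permutations_of_set V. I x xs * I y xs)
        \<le> of_bool (x = y) * (fact n * (real l / real n)) + fact n * (real l / real n)\<^sup>2"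
      using pair[OF xy] single[OF xy(1)] by (cases "x = y") (auto simp: idem)
  qed
  also have "\<dots> = fact n * m + fact n * m\<^sup>2"
  proof -
    have "(\<Sum>y\<in>Q. of_bool (x = y) * d) = d" if "x \<in> Q" for x and d :: real
      using finQ that by (simp add: sum_distrib_right[symmetric] of_bool_def)
    then have total: "(\<Sum>x\<in>Q. \<Sum>y\<in>Q. of_bool (x = y) * d + e) = c * d + c\<^sup>2 * e" for d e :: real
      by (simp add: sum.distrib c_def power2_eq_square algebra_simps)
    show ?thesis unfolding total m by (simp only: power_mult_distrib mult_ac)
  qed
  finally have second: "(\<Sum>xs\<in>permutations_of_set V. (\<Sum>x\<in>Q. I x xs)\<^sup>2) \<le> fact n * m + fact n * m\<^sup>2" .
  have "(\<Sum>xs\<in>permutations_of_set V. (real (card (Q \<inter> set (take l xs))) - m)\<^sup>2)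
      = (\<Sum>xs\<in>permutations_of_set V. (\<Sum>x\<in>Q. I x xs)\<^sup>2)
        - 2 * m * (\<Sum>xs\<in>permutations_of_set V. \<Sum>x\<in>Q. I x xs) + fact n * m\<^sup>2"
    using V by (simp add: Y power2_diff sum.distrib sum_subtractf sum_distrib_left n_def mult_ac)
  also have "\<dots> \<le> fact n * m"
    using second unfolding first by (simp add: power2_eq_square algebra_simps)
  finally show ?thesis by (simp add: n_def)
qed (simp add: m_def)

text \<open>The variance is at most the mean, hence at most \<open>b\<close>, and a count above
  \<open>b + d\<close> deviates from the mean by at least \<open>d\<close>. The bound
  \<open>b\<close> replaces the mean because the application controls the mean only from
  above.\<close>

lemma prefix_count_Chebyshev:
  assumes V: "finite V" "Q \<subseteq> V" and l: "l \<le> card V" and "d > 0"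
    and "real (card Q) * real l / real (card V) \<le> b"
  shows "real (card {xs \<in> permutations_of_set V. real (card (Q \<inter> set (take l xs))) > b + d})
    \<le> fact (card V) * b / d\<^sup>2"
proof -
  define m where "m = real (card Q) * real l / real (card V)"
  let ?A = "{xs \<in> permutations_of_set V. real (card (Q \<inter> set (take l xs))) > b + d}"
  have "real (card ?A) * d\<^sup>2 = (\<Sum>xs\<in>?A. d\<^sup>2)" by simp
  also have "\<dots> \<le> (\<Sum>xs\<in>?A. (real (card (Q \<inter> set (take l xs))) - m)\<^sup>2)"
    using assms by (intro sum_mono power_mono) (auto simp: m_def)
  also have "\<dots> \<le> (\<Sum>xs\<in>permutations_of_set V. (real (card (Q \<inter> set (take l xs))) - m)\<^sup>2)"
    by (intro sum_mono2) auto
  also have "\<dots> \<le> fact (card V) * m"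
    using prefix_count_variance[OF V l] by (simp add: m_def)
  also have "\<dots> \<le> fact (card V) * b"
    using assms by (intro mult_left_mono) (auto simp: m_def)
  finally show ?thesis using \<open>d > 0\<close> by (simp add: field_simps)
qed

section \<open>The random order argument\<close>

text \<open>Inside the prefix, \<open>x\<close> would have been selected or rejected, and either way
  its marginal over \<open>S\<close> would be below the threshold; so \<open>x\<close> comes later
  and \<open>S\<close> depends on \<open>ys\<close> alone. Moved to position \<open>q\<close>, it
  meets a subset of \<open>S\<close>, where there is room and its marginal is at least as
  large.\<close>

lemma reinserted_element_selected:
  assumes f: "mono_submod_normalized V f" and V: "finite V" "x \<in> V"
    and ys: "ys \<in> permutations_of_set (V - {x})" and "p < card V" "q < l" "l \<le> card V"
    and pos: "alg2_threshold k opt > 0"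
  defines "S \<equiv> alg2 f k opt (take l (insert_nth p x ys))"
  assumes few: "card S < k" and large: "f (insert x S) - f S \<ge> alg2_threshold k opt"
  shows "l \<le> p" "x \<in> alg2 f k opt (take l (insert_nth q x ys))"
proof -
  note len = length_permutation_remove[OF V ys]
  have perm: "set (insert_nth p x ys) \<subseteq> V"
    using len V by (auto simp: insert_nth_def dest: in_set_takeD in_set_dropD)
  show "l \<le> p"
  proof (rule ccontr)
    assume "\<not> l \<le> p"
    then have "x \<in> set (take l (insert_nth p x ys))"
      using len \<open>p < card V\<close> by (simp add: mem_take_insert_nth_self)
    moreover have "x \<notin> S"
    proof
      assume "x \<in> S"
      then show False using large pos by (simp add: insert_absorb)
    qed
    moreover have "set (take l (insert_nth p x ys)) \<subseteq> V"
      using perm set_take_subset by fastforce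
    ultimately have "f (insert x S) - f S < alg2_threshold k opt"
      using few unfolding S_def by (intro alg2_rejected_marginal_less[OF f]) auto
    then show False using large by simp
  qed
  then have S: "S = alg2 f k opt (take l ys)"
    using len \<open>p < card V\<close> by (simp add: S_def take_insert_nth_ge)
  have "take l ys = take q ys @ take (l - q) (drop q ys)"
    using \<open>q < l\<close> by (metis le_add_diff_inverse less_imp_le take_add)
  then have sub: "alg2 f k opt (take q ys) \<subseteq> S"
    unfolding S by (metis alg2_append_mono)
  have "S \<subseteq> V"
    using alg2_subset[of f k opt "take l ys"] len(3) set_take_subset[of l ys] unfolding S by blast
  then have "f (insert x S) - f S \<le> f (insert x (alg2 f k opt (take q ys))) - f (alg2 f k opt (take q ys))"
    using sub V by (intro marginal_antimono[OF f]) auto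
  moreover have "card (alg2 f k opt (take q ys)) < k"
    using card_mono[OF _ sub] few S by simp
  ultimately have "x \<in> alg2 f k opt (take q ys @ [x])"
    using large unfolding alg2_snoc alg2_step_def by simp
  moreover have "q \<le> length ys" using len \<open>q < l\<close> \<open>l \<le> card V\<close> by simp
  then have "take l (insert_nth q x ys) = (take q ys @ [x]) @ take (l - Suc q) (drop q ys)"
    using \<open>q < l\<close> by (simp add: insert_nth_def take_Cons' min_def)
  ultimately show "x \<in> alg2 f k opt (take l (insert_nth q x ys))"
    using alg2_append_mono by (metis subsetD)
qed

text \<open>The cap on the number of elements of \<open>Q\<close> in the prefix is built into the double count:
  moving a single element into the prefix raises that number by at most one.\<close>

lemma selected_count_lower_bound:
  fixes V :: "'a set" and h a :: real
  assumes f: "mono_submod_normalized V f" and V: "finite V" "Q \<subseteq> V" and l: "l \<le> card V"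
    and pos: "alg2_threshold k opt > 0" and "h \<ge> 0" "s \<ge> 0" "a \<ge> 0"
    and good: "\<And>xs. xs \<in> G \<Longrightarrow> card (alg2 f k opt (take l xs)) < k"
      "\<And>xs. xs \<in> G \<Longrightarrow> h \<le> real (card {e \<in> Q. f (insert e (alg2 f k opt (take l xs)))
        - f (alg2 f k opt (take l xs)) \<ge> alg2_threshold k opt})"
    and G: "G \<subseteq> permutations_of_set V" "\<And>xs. xs \<in> G \<Longrightarrow> real (card (Q \<inter> set (take l xs))) \<le> a"
  shows "real l * (h * real (card G)) \<le> real (card V) * (s * fact (card V) + (a + 1) *
    real (card {xs \<in> permutations_of_set V. s \<le> real (card (Q \<inter> alg2 f k opt (take l xs)))}))"
proof -
  let ?PV = "permutations_of_set V"
  define S where "S xs = alg2 f k opt (take l xs)" for xs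
  define Y where "Y xs = real (card (Q \<inter> set (take l xs)))" for xs
  define B where "B xs = {e \<in> Q. f (insert e (S xs)) - f (S xs) \<ge> alg2_threshold k opt}" for xs
  let ?A = "{xs \<in> ?PV. s \<le> real (card (Q \<inter> S xs))}"
  have finQ: "finite Q" by (rule finite_subset[OF V(2) V(1)])
  \<comment> \<open>For fixed \<open>x\<close>, a good order in which \<open>x\<close> has a large
    marginal after the prefix is turned into \<open>l\<close> orders in which \<open>x\<close> is
    selected, by moving \<open>x\<close> alone.\<close>
  have swap: "real l * (\<Sum>xs\<in>?PV. of_bool (xs \<in> G \<and> x \<in> B xs))
      \<le> real (card V) * (\<Sum>xs\<in>?PV. of_bool (x \<in> S xs \<and> Y xs \<le> a + 1))" if x: "x \<in> Q" for x
  proof (rule reinsertion_count)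
    fix ys p q assume ys: "ys \<in> permutations_of_set (V - {x})" and pq: "p < card V" "q < l"
      and P: "insert_nth p x ys \<in> G \<and> x \<in> B (insert_nth p x ys)"
    have xV: "x \<in> V" using x V by blast
    note len = length_permutation_remove[OF V(1) xV ys]
    note sel = reinserted_element_selected[OF f V(1) xV ys pq l pos]
    have lp: "l \<le> p" and selected: "x \<in> S (insert_nth q x ys)"
      using P good(1) by (auto simp: S_def B_def intro: sel)
    \<comment> \<open>The move brings only \<open>x\<close> into the prefix and pushes one element
      out, which is why the cap \<open>a\<close> becomes \<open>a + 1\<close>.\<close>
    have "set (take l (insert_nth q x ys)) \<subseteq> insert x (set (take l ys))"
      using set_take_insert_nth_less[of q l ys x] set_take_subset_set_take[of "l - 1" l ys] pq l len
      by auto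
    then have "Q \<inter> set (take l (insert_nth q x ys)) \<subseteq> insert x (Q \<inter> set (take l ys))" by blast
    then have "card (Q \<inter> set (take l (insert_nth q x ys))) \<le> card (insert x (Q \<inter> set (take l ys)))"
      by (intro card_mono) auto
    also have "\<dots> \<le> Suc (card (Q \<inter> set (take l ys)))"
      by (simp add: card_insert_if)
    also have "take l ys = take l (insert_nth p x ys)"
      using lp pq len by (simp add: take_insert_nth_ge)
    finally have "Y (insert_nth q x ys) \<le> a + 1"
      using G(2)[OF conjunct1[OF P]] by (simp add: Y_def)
    then show "x \<in> S (insert_nth q x ys) \<and> Y (insert_nth q x ys) \<le> a + 1"
      using selected by simp
  qed (use V x l in auto)
  have "real l * (h * real (card G)) = real l * (\<Sum>xs\<in>?PV. of_bool (xs \<in> G) * h)"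
    using G(1) by (simp add: sum_distrib_right[symmetric] Int_absorb1 mult.commute)
  also have "\<dots> \<le> real l * (\<Sum>xs\<in>?PV. \<Sum>x\<in>Q. of_bool (xs \<in> G \<and> x \<in> B xs))"
  proof (intro mult_left_mono sum_mono)
    fix xs
    have "Q \<inter> B xs = B xs" by (auto simp: B_def)
    then have "(\<Sum>x\<in>Q. of_bool (xs \<in> G \<and> x \<in> B xs)) = of_bool (xs \<in> G) * real (card (B xs))"
      using finQ by (simp add: of_bool_conj sum_distrib_left[symmetric])
    moreover have "h \<le> real (card (B xs))" if "xs \<in> G"
      using good(2)[OF that] by (simp only: B_def S_def)
    ultimately show "of_bool (xs \<in> G) * h \<le> (\<Sum>x\<in>Q. of_bool (xs \<in> G \<and> x \<in> B xs))"
      by simp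
  qed simp
  also have "\<dots> = (\<Sum>x\<in>Q. real l * (\<Sum>xs\<in>?PV. of_bool (xs \<in> G \<and> x \<in> B xs)))"
    by (subst sum.swap) (simp add: sum_distrib_left)
  also have "\<dots> \<le> (\<Sum>x\<in>Q. real (card V) * (\<Sum>xs\<in>?PV. of_bool (x \<in> S xs \<and> Y xs \<le> a + 1)))"
    by (intro sum_mono swap)
  also have "\<dots> = real (card V) * (\<Sum>xs\<in>?PV. \<Sum>x\<in>Q. of_bool (x \<in> S xs \<and> Y xs \<le> a + 1))"
    by (subst sum.swap) (simp add: sum_distrib_left)
  \<comment> \<open>An order contributes nothing if its prefix count exceeds \<open>a + 1\<close>.
    Otherwise it contributes less than \<open>s\<close>, or it is one of the counted orders and
    contributes at most \<open>a + 1\<close>.\<close>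
  also have "\<dots> \<le> real (card V) * (\<Sum>xs\<in>?PV. s + (a + 1) * of_bool (s \<le> real (card (Q \<inter> S xs))))"
  proof (intro mult_left_mono sum_mono)
    fix xs
    have "card (Q \<inter> S xs) \<le> card (Q \<inter> set (take l xs))"
      using alg2_subset[of f k opt "take l xs"] by (intro card_mono) (auto simp: S_def)
    then have "real (card (Q \<inter> S xs)) \<le> Y xs" by (simp add: Y_def)
    moreover have "(\<Sum>x\<in>Q. of_bool (x \<in> S xs \<and> Y xs \<le> a + 1))
        = real (card (Q \<inter> S xs)) * of_bool (Y xs \<le> a + 1)"
      using finQ by (simp add: of_bool_conj sum_distrib_right[symmetric])
    ultimately show "(\<Sum>x\<in>Q. of_bool (x \<in> S xs \<and> Y xs \<le> a + 1))
        \<le> s + (a + 1) * of_bool (s \<le> real (card (Q \<inter> S xs)))"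
      using \<open>s \<ge> 0\<close> \<open>a \<ge> 0\<close> by (auto simp: of_bool_def)
  qed simp
  also have "(\<Sum>xs\<in>?PV. s + (a + 1) * of_bool (s \<le> real (card (Q \<inter> S xs))))
      = s * fact (card V) + (a + 1) * real (card ?A)"
    using V by (simp add: sum.distrib sum_distrib_left[symmetric] Collect_conj_eq mult.commute)
  finally show ?thesis by (simp add: S_def)
qed

theorem mainTheorem9:
  fixes V :: "'a set" and f :: "'a set \<Rightarrow> real" and k :: nat
  assumes "finite V"
    and "mono_submod_normalized V f"
    and "k \<le> card V"
    and "real k \<ge> 2 * 10^8"
    and "\<not> (\<exists>D. dense V f k D)"
    and "prob_perm V (\<lambda>xs. f (alg2_SL f k (OPT V f k) (1/1000) xs) \<le> (3/1000) * OPT V f k) \<ge> 99/100"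
  shows "prob_perm V (\<lambda>xs. f (alg2 f k (OPT V f k) xs) \<ge> (1 + eps_c) / 2 * OPT V f k)
           \<ge> (49/100) * eta_c"
proof -
  let ?PV = "permutations_of_set V"
  define n where "n = card V"
  define N where "N = (fact n :: real)"
  define opt where "opt = OPT V f k"
  define l where "l = nat \<lfloor>1 / 1000 * real n\<rfloor>"
  define S where "S xs = alg2 f k opt (take l xs)" for xs
  \<comment> \<open>\<open>b\<close> bounds the mean number of elements of \<open>Q\<close> in the
    prefix from above, and \<open>a\<close> leaves ten percent of slack for the Chebyshev
    bound.\<close>
  define b where "b = real k / 1000"
  define a where "a = b + b / 10"
  define s where "s = 2 * eps_c * real k"
  note f = assms(2)
  obtain Q where Q: "Q \<subseteq> V" "card Q \<le> k" "f Q = opt"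
    using OPT_attained[OF \<open>finite V\<close>] unfolding opt_def by blast
  define Y where "Y xs = real (card (Q \<inter> set (take l xs)))" for xs
  have opt: "opt > 0" using OPT_pos_if_no_dense[OF f assms(5)] by (simp add: opt_def)
  have k: "real k \<ge> 2 * 10^8" "real k > 0" using assms(4) by auto
  have n: "real n \<ge> real k" "real n > 0" using assms(3) k by (auto simp: n_def)
  have N: "N > 0" "real (card ?PV) = N" using assms(1) by (auto simp: N_def n_def)
  have b: "b \<ge> 2 * 10^5" using k by (simp add: b_def)
  \<comment> \<open>Rounding down costs less than 1, which is at most \<open>n / 10^8\<close> since
    \<open>n \<ge> k \<ge> 2 * 10^8\<close>.\<close>
  have l: "real l \<le> real n / 1000" "real l \<ge> 99999 / 10^8 * real n"
  proof -
    have "real l = of_int \<lfloor>1 / 1000 * real n\<rfloor>" by (simp add: l_def)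
    then have "real l \<le> 1 / 1000 * real n" "real l > 1 / 1000 * real n - 1" by linarith+
    then show "real l \<le> real n / 1000" "real l \<ge> 99999 / 10^8 * real n"
      using n k by auto
  qed
  then have ln: "l \<le> card V" using n by (simp add: n_def)

  define F where "F = {xs \<in> ?PV. f (S xs) \<le> 3 / 1000 * opt}"
  define T where "T = {xs \<in> ?PV. Y xs > b + b / 10}"
  define A where "A = {xs \<in> ?PV. s \<le> real (card (Q \<inter> S xs))}"
  have F: "real (card F) \<ge> 99 / 100 * N"
  proof -
    have "F = {xs \<in> ?PV. f (alg2_SL f k opt (1 / 1000) xs) \<le> 3 / 1000 * opt}"
      by (auto simp: F_def S_def alg2_SL_def l_def n_def dest: length_finite_permutations_of_set)
    then show ?thesis
      using assms(6) N unfolding prob_perm_def opt_def[symmetric] by (simp add: field_simps)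
  qed
  have "real (card T) \<le> N * b / (b / 10)\<^sup>2"
    unfolding T_def Y_def N_def n_def
  proof (rule prefix_count_Chebyshev)
    have "real (card Q) * real l \<le> real k * (real n / 1000)"
      using Q l by (intro mult_mono) auto
    then show "real (card Q) * real l / real (card V) \<le> b"
      using n by (simp add: b_def n_def field_simps)
  qed (use assms Q ln b in auto)
  also have "\<dots> = N * (100 / b)" using b by (simp add: field_simps power2_eq_square)
  \<comment> \<open>From \<open>b \<ge> 2 * 10^5\<close>.\<close>
  also have "\<dots> \<le> N * (5 / 10^4)"
    using b N by (intro mult_left_mono) (auto simp: field_simps)
  finally have T: "real (card T) \<le> N * (5 / 10^4)" .
  \<comment> \<open>The good orders of the double count are \<open>F - T\<close>; their share is at
    least 0.99 - 0.0005 = 0.9895.\<close>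
  have FT: "real (card (F - T)) \<ge> 9895 / 10^4 * N"
    using F T diff_card_le_card_Diff[of T F] by (simp add: T_def)

  have count: "real l * ((eta_c * real k) * real (card (F - T))) \<le>
      real (card V) * (s * fact (card V) + (a + 1) * real (card A))"
    unfolding A_def S_def
  proof (rule selected_count_lower_bound[OF f])
    fix xs assume xs: "xs \<in> F - T"
    have FS: "f (S xs) \<le> 3 / 1000 * opt" using xs by (simp add: F_def)
    have SV: "S xs \<subseteq> V"
      using xs alg2_subset[of f k opt "take l xs"] set_take_subset[of l xs]
      by (auto simp: F_def S_def permutations_of_set_def)
    \<comment> \<open>Reaching the cap within the prefix would already give a value above
      \<open>opt / 2\<close>, far more than \<open>3 / 1000 * opt\<close>.\<close>
    show "card (alg2 f k opt (take l xs)) < k"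
    proof (rule ccontr)
      assume "\<not> card (alg2 f k opt (take l xs)) < k"
      then have "card (S xs) = k" using card_alg2_le[of f k opt "take l xs"] by (simp add: S_def)
      then have "real k * alg2_threshold k opt \<le> f (S xs)"
        using alg2_value_ge[where f = f and k = k and opt = opt and xs = "take l xs"]
          mono_submodD(1)[OF f] by (simp add: S_def)
      then show False using FS k opt by (simp add: eps_c_def)
    qed
    show "eta_c * real k \<le> real (card {e \<in> Q. f (insert e (alg2 f k opt (take l xs)))
        - f (alg2 f k opt (take l xs)) \<ge> alg2_threshold k opt})"
      using many_large_marginals_if_no_dense[OF f assms(1,5), of Q "S xs"] Q SV FS
      unfolding opt_def[symmetric] S_def by simp
    show "real (card (Q \<inter> set (take l xs))) \<le> a"
      using xs by (auto simp: F_def T_def Y_def a_def)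
  qed (use assms Q ln opt k b in \<open>auto simp: F_def eps_c_def eta_c_def a_def s_def\<close>)

  have A: "real (card A) \<ge> 49 / 100 * eta_c * N"
  proof -
    have "(99999 / 10^8 * real n) * ((eta_c * real k) * (9895 / 10^4 * N))
        \<le> real l * ((eta_c * real k) * real (card (F - T)))"
      using l FT N k by (intro mult_mono) (auto simp: eta_c_def)
    also have "\<dots> \<le> real n * (s * N + (a + 1) * real (card A))"
      using count by (simp add: n_def N_def)
    finally have "real n * (99999 / 10^8 * ((eta_c * real k) * (9895 / 10^4 * N)))
        \<le> real n * (s * N + (a + 1) * real (card A))" by (simp only: mult_ac)
    then have "99999 / 10^8 * ((eta_c * real k) * (9895 / 10^4 * N)) \<le> s * N + (a + 1) * real (card A)"
      using n by (simp only: mult_le_cancel_left_pos)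
    \<comment> \<open>Here \<open>a + 1\<close> is \<open>1.1 * k / 1000 + 1\<close>, and the
      summand 1 is absorbed by \<open>k / 10^6\<close>.\<close>
    also have "(a + 1) * real (card A) \<le> (real k * (1101 / 10^6)) * real (card A)"
      using k by (intro mult_right_mono) (auto simp: a_def b_def)
    finally have "real k * (99999 / 10^8 * (eta_c * (9895 / 10^4 * N)))
        \<le> real k * (2 * eps_c * N + 1101 / 10^6 * real (card A))"
      by (simp add: s_def algebra_simps)
    then have "99999 / 10^8 * (eta_c * (9895 / 10^4 * N)) \<le> 2 * eps_c * N + 1101 / 10^6 * real (card A)"
      using k by (simp only: mult_le_cancel_left_pos)
    \<comment> \<open>The left side exceeds 4.947 * 10^-8 times \<open>N\<close>. Subtracting 2 *
      10^-8 and dividing by 0.001101 leaves more than 2.67 * 10^-5, while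
      \<open>49 / 100 * eta_c\<close> is 2.45 * 10^-5.\<close>
    then show ?thesis using N by (simp add: eta_c_def eps_c_def)
  qed

  let ?W = "{xs \<in> ?PV. f (alg2 f k opt xs) \<ge> (1 + eps_c) / 2 * opt}"
  have "A \<subseteq> ?W"
  proof
    fix xs assume xs: "xs \<in> A"
    have "S xs \<subseteq> alg2 f k opt xs"
      using alg2_append_mono[of f k opt "take l xs" "drop l xs"] by (simp add: S_def)
    then have "card (Q \<inter> S xs) \<le> card (Q \<inter> alg2 f k opt xs)"
      by (intro card_mono) auto
    then have "2 * eps_c * real k \<le> real (card (Q \<inter> alg2 f k opt xs))"
      using xs by (simp add: A_def s_def)
    then show "xs \<in> ?W"
      using alg2_value_if_many_optimal_selected[OF f assms(1) _ Q opt, of xs] xs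
      by (auto simp: A_def permutations_of_set_def)
  qed
  then have "real (card A) \<le> real (card ?W)"
    by (simp add: card_mono)
  with A have "49 / 100 * eta_c * N \<le> real (card ?W)" by linarith
  then show ?thesis
    unfolding prob_perm_def opt_def[symmetric] N(2) by (simp only: pos_le_divide_eq[OF N(1)])
qed

end
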